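(* Let $d\ge1$, $L,R,K>0$, $m\in\mathbb Z^d\setminus\{0\}$ and $\tau\in\mathbb R$. Then $$\#\left\{k\in\mathbb Z^d:\ |k|_\infty\sim K,\ |4Rk\cdot m-\tau|\le L\right\}\lesssim K^{d-1}\left(1+\frac{L}{R|m|}\right),$$ where the implicit constant depends only on $d$ (and on the constants implicit in $\sim$).
   Context: $|k|_\infty=\max_j|k_j|$. $|k|_\infty\sim K$ means $c_1K\le|k|_\infty\le c_2K$ for fixed constants $0<c_1<c_2$. *)

theory Defs
  imports "HOL-Analysis.Analysis"
begin

text \<open>The lattice of integer vectors, as a subset of real Euclidean space, so that the
  library's inner product, Euclidean norm and sup-norm (\<^const>\<open>infnorm\<close>) apply directly.\<close>

definition int_lattice :: "(real ^ 'n) set" where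
  "int_lattice = {x. \<forall>i. x $ i \<in> \<int>}"

end

theory Submission imports Defs begin

text \<open>
  Choose a coordinate \<open>j\<close> at which \<open>\<bar>m $ j\<bar>\<close> is largest, so that \<open>\<bar>m $ j\<bar>\<close> is comparable to the
  Euclidean norm of \<open>m\<close>.  The coordinates of \<open>k\<close> other than \<open>j\<close> are integers of size at most
  \<open>c2 * K\<close>, which leaves at most \<open>(2 * c2 * K + 1) ^ (d - 1)\<close> choices for them.  Once these are
  fixed, the constraint \<open>\<bar>4 * R * (k \<bullet> m) - \<tau>\<bar> \<le> L\<close> confines the integer \<open>k $ j\<close> to an interval
  of length \<open>L / (2 * R * \<bar>m $ j\<bar>)\<close>, which leaves at most \<open>1 + L / (2 * R * \<bar>m $ j\<bar>)\<close> choices.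
  The lemma \<open>card_slab_le\<close> is the product of these two counts.

  The lower bound \<open>c1 * K \<le> infnorm k\<close> is what allows \<open>2 * c2 * K + 1\<close> to be replaced by a multiple
  of \<open>K\<close>: it excludes \<open>k = 0\<close>, and a nonzero lattice vector has sup-norm at least 1, so the set
  is empty unless \<open>c2 * K \<ge> 1\<close>, in which case \<open>2 * c2 * K + 1 \<le> 3 * c2 * K\<close>.
\<close>

lemma card_int_le_diameter:
  fixes A :: "int set" and D :: real
  assumes fin: "finite A" and D: "0 \<le> D"
    and diam: "\<And>x y. x \<in> A \<Longrightarrow> y \<in> A \<Longrightarrow> \<bar>real_of_int x - real_of_int y\<bar> \<le> D"
  shows "real (card A) \<le> 1 + D"
proof (cases "A = {}")
  case False
  have "A \<subseteq> {Min A..Max A}"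
    using fin by auto
  then have "card A \<le> nat (Max A - Min A + 1)"
    using card_mono[of "{Min A..Max A}" A] by simp
  moreover have "Min A \<le> Max A"
    using fin False by simp
  moreover have "\<bar>real_of_int (Max A) - real_of_int (Min A)\<bar> \<le> D"
    using fin False by (intro diam Max_in Min_in)
  ultimately show ?thesis
    by linarith
qed (use D in simp)

lemma card_le_image_times_fibre:
  fixes N :: real
  assumes "finite S" and "\<And>y. y \<in> f ` S \<Longrightarrow> real (card {x \<in> S. f x = y}) \<le> N"
  shows "real (card S) \<le> real (card (f ` S)) * N"
proof -
  have "real (card S) = (\<Sum>y\<in>f ` S. real (card {x \<in> S. f x = y}))"
    using sum.image_gen[OF assms(1), of "\<lambda>_. 1::real" f] by simp
  also have "\<dots> \<le> (\<Sum>y\<in>f ` S. N)"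
    by (intro sum_mono assms(2))
  finally show ?thesis
    by simp
qed

lemma int_lattice_floor:
  assumes "k \<in> int_lattice"
  shows "real_of_int \<lfloor>k $ i\<rfloor> = k $ i"
  using assms by (auto simp: int_lattice_def)

lemma floor_component_bound:
  assumes "k \<in> int_lattice" and "infnorm k \<le> B"
  shows "\<lfloor>k $ i\<rfloor> \<in> {- \<lfloor>B\<rfloor>..\<lfloor>B\<rfloor>}"
proof -
  have "\<bar>k $ i\<bar> \<le> B"
    using component_le_infnorm_cart[of k i] assms(2) by linarith
  then show ?thesis
    using int_lattice_floor[OF assms(1), of i] by (auto; linarith)
qed

lemma finite_int_lattice_box:
  "finite {k :: real ^ 'n. k \<in> int_lattice \<and> infnorm k \<le> B}"
proof (rule finite_subset)
  let ?v = "\<lambda>g :: 'n \<Rightarrow> int. \<chi> i. real_of_int (g i)"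
  let ?P = "PiE (UNIV :: 'n set) (\<lambda>_. {- \<lfloor>B\<rfloor>..\<lfloor>B\<rfloor>})"
  show "{k. k \<in> int_lattice \<and> infnorm k \<le> B} \<subseteq> ?v ` ?P"
  proof clarify
    fix k :: "real ^ 'n"
    assume k: "k \<in> int_lattice" "infnorm k \<le> B"
    have "k = ?v (\<lambda>i. \<lfloor>k $ i\<rfloor>)"
      by (simp add: vec_eq_iff int_lattice_floor[OF k(1)])
    moreover have "(\<lambda>i. \<lfloor>k $ i\<rfloor>) \<in> ?P"
      using floor_component_bound[OF k] by auto
    ultimately show "k \<in> ?v ` ?P"
      by (rule image_eqI)
  qed
  show "finite (?v ` ?P)"
    by (intro finite_imageI finite_PiE) auto
qed

lemma infnorm_ge_1_if_int_lattice:
  assumes "k \<in> int_lattice" "k \<noteq> 0"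
  shows "1 \<le> infnorm k"
proof -
  obtain i where "k $ i \<noteq> 0"
    using assms(2) by (auto simp: vec_eq_iff)
  then have "1 \<le> \<bar>k $ i\<bar>"
    using assms(1) by (intro Ints_nonzero_abs_ge1) (auto simp: int_lattice_def)
  then show ?thesis
    using component_le_infnorm_cart[of k i] by linarith
qed

lemma exists_component_ge_norm:
  fixes m :: "real ^ 'n"
  obtains j where "norm m \<le> real CARD('n) * \<bar>m $ j\<bar>"
proof -
  have "Max (range (\<lambda>i. \<bar>m $ i\<bar>)) \<in> range (\<lambda>i. \<bar>m $ i\<bar>)"
    by (intro Max_in) auto
  then obtain j where j: "Max (range (\<lambda>i. \<bar>m $ i\<bar>)) = \<bar>m $ j\<bar>"
    by blast
  have "norm m \<le> (\<Sum>i\<in>UNIV. \<bar>m $ i\<bar>)"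
    by (rule norm_le_l1_cart)
  also have "\<dots> \<le> (\<Sum>i\<in>(UNIV :: 'n set). \<bar>m $ j\<bar>)"
    by (intro sum_mono) (simp flip: j)
  finally show thesis
    by (intro that[of j]) simp
qed

text \<open>
  Two lattice points of the slab with the same coordinates off \<open>j\<close> differ by a multiple \<open>t\<close> of
  the \<open>j\<close>-th unit vector, and \<open>\<bar>t * m $ j\<bar> \<le> 2 * W\<close> by the triangle inequality; so on each
  fibre of the projection forgetting coordinate \<open>j\<close>, the values of that coordinate form a set of
  integers of diameter at most \<open>2 * W / \<bar>m $ j\<bar>\<close>.
\<close>
lemma card_slab_le:
  fixes m :: "real ^ 'n" and B W \<sigma> :: real
  assumes B: "0 \<le> B" and W: "0 \<le> W" and mj: "m $ j \<noteq> 0"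
  shows "real (card {k \<in> int_lattice. infnorm k \<le> B \<and> \<bar>k \<bullet> m - \<sigma>\<bar> \<le> W})
           \<le> (2 * B + 1) ^ (CARD('n) - 1) * (1 + 2 * W / \<bar>m $ j\<bar>)"
proof -
  define S where "S = {k \<in> int_lattice. infnorm k \<le> B \<and> \<bar>k \<bullet> m - \<sigma>\<bar> \<le> W}"
  \<comment> \<open>On the lattice the floor loses nothing; it makes the projection integer-valued, so that
    its image can be compared with a finite product of integer intervals.\<close>
  define f where "f k = restrict (\<lambda>i. \<lfloor>k $ i\<rfloor>) (- {j})" for k :: "real ^ 'n"
  have lat: "k \<in> int_lattice" if "k \<in> S" for k
    using that by (simp add: S_def)
  have fin: "finite S"
    by (rule finite_subset[OF _ finite_int_lattice_box[of B]]) (auto simp: S_def)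

  have off: "k $ i = k' $ i" if "k \<in> S" "k' \<in> S" "f k = f k'" "i \<noteq> j" for k k' i
  proof -
    have "\<lfloor>k $ i\<rfloor> = \<lfloor>k' $ i\<rfloor>"
      using fun_cong[OF that(3), of i] that(4) by (simp add: f_def)
    then show ?thesis
      using int_lattice_floor[OF lat, of _ i] that(1,2) by metis
  qed
  have diff: "\<bar>k $ j - k' $ j\<bar> \<le> 2 * W / \<bar>m $ j\<bar>"
    if k: "k \<in> S" "k' \<in> S" "f k = f k'" for k k'
  proof -
    have "(k - k') \<bullet> m = (\<Sum>i\<in>UNIV. (k $ i - k' $ i) * m $ i)"
      by (simp add: inner_vec_def)
    also have "\<dots> = (\<Sum>i\<in>{j}. (k $ i - k' $ i) * m $ i)"
      using off[OF k] by (intro sum.mono_neutral_right) auto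
    finally have "(k $ j - k' $ j) * m $ j = (k \<bullet> m - \<sigma>) - (k' \<bullet> m - \<sigma>)"
      by (simp add: inner_diff_left)
    also have "\<bar>\<dots>\<bar> \<le> 2 * W"
      using k(1,2) unfolding S_def mem_Collect_eq by linarith
    finally show ?thesis
      using mj by (simp add: abs_mult pos_le_divide_eq)
  qed

  have fibre: "real (card {k \<in> S. f k = y}) \<le> 1 + 2 * W / \<bar>m $ j\<bar>" for y
  proof -
    let ?F = "{k \<in> S. f k = y}"
    have "inj_on (\<lambda>k. \<lfloor>k $ j\<rfloor>) ?F"
    proof (rule inj_onI)
      fix k k' assume k: "k \<in> ?F" "k' \<in> ?F" and eq: "\<lfloor>k $ j\<rfloor> = \<lfloor>k' $ j\<rfloor>"
      have "k $ j = k' $ j"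
        using int_lattice_floor[OF lat, of k j] int_lattice_floor[OF lat, of k' j] k eq
        by (metis (no_types, lifting) mem_Collect_eq)
      then show "k = k'"
        using off[of k k'] k by (auto simp: vec_eq_iff) metis
    qed
    then have "real (card ?F) = real (card ((\<lambda>k. \<lfloor>k $ j\<rfloor>) ` ?F))"
      by (simp add: card_image)
    also have "\<dots> \<le> 1 + 2 * W / \<bar>m $ j\<bar>"
      using fin W diff by (intro card_int_le_diameter) (auto simp: int_lattice_floor[OF lat])
    finally show ?thesis .
  qed

  have "f ` S \<subseteq> PiE (- {j}) (\<lambda>_. {- \<lfloor>B\<rfloor>..\<lfloor>B\<rfloor>})"
    unfolding f_def
    by (intro image_subsetI restrict_PiE_iff[THEN iffD2] ballI floor_component_bound)
      (simp_all add: S_def)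
  then have "card (f ` S) \<le> card (PiE (- {j}) (\<lambda>_. {- \<lfloor>B\<rfloor>..\<lfloor>B\<rfloor>}))"
    by (intro card_mono finite_PiE) auto
  also have "\<dots> = nat (2 * \<lfloor>B\<rfloor> + 1) ^ (CARD('n) - 1)"
    by (simp add: card_PiE card_Diff_singleton Compl_eq_Diff_UNIV add_ac)
  finally have "real (card (f ` S)) \<le> real (nat (2 * \<lfloor>B\<rfloor> + 1)) ^ (CARD('n) - 1)"
    by (metis of_nat_le_iff of_nat_power)
  also have "\<dots> \<le> (2 * B + 1) ^ (CARD('n) - 1)"
    using B by (intro power_mono) linarith+
  finally have image: "real (card (f ` S)) \<le> (2 * B + 1) ^ (CARD('n) - 1)" .

  have "real (card S) \<le> real (card (f ` S)) * (1 + 2 * W / \<bar>m $ j\<bar>)"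
    by (rule card_le_image_times_fibre[OF fin fibre])
  also have "\<dots> \<le> (2 * B + 1) ^ (CARD('n) - 1) * (1 + 2 * W / \<bar>m $ j\<bar>)"
    using W by (intro mult_right_mono image) simp
  finally show ?thesis
    by (simp add: S_def)
qed

theorem lemma3p6:
  fixes c1 c2 :: real
  assumes "0 < c1" and "c1 < c2"
  shows "\<exists>C>0. \<forall>(L::real) (R::real) (K::real) (\<tau>::real) (m :: real ^ 'n).
           L > 0 \<longrightarrow> R > 0 \<longrightarrow> K > 0 \<longrightarrow> m \<in> int_lattice - {0} \<longrightarrow>
           (let S = {k \<in> int_lattice. c1 * K \<le> infnorm k \<and> infnorm k \<le> c2 * K \<and>
                                      \<bar>4 * R * (k \<bullet> m) - \<tau>\<bar> \<le> L}
            in finite S \<and>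
               real (card S) \<le> C * K ^ (CARD('n) - 1) * (1 + L / (R * norm m)))"
proof -
  let ?d = "CARD('n)"
  define C where "C = (3 * c2) ^ (?d - 1) * real ?d"
  have c2: "0 < c2"
    using assms by simp
  have "finite S \<and> real (card S) \<le> C * K ^ (?d - 1) * (1 + L / (R * norm m))"
    if pos: "L > 0" "R > 0" "K > 0" and m: "m \<in> int_lattice - {0}"
      and S: "S = {k \<in> int_lattice. c1 * K \<le> infnorm k \<and> infnorm k \<le> c2 * K \<and>
                      \<bar>4 * R * (k \<bullet> m) - \<tau>\<bar> \<le> L}"
    for L R K \<tau> :: real and m :: "real ^ 'n" and S
  proof
    show "finite S"
      by (rule finite_subset[OF _ finite_int_lattice_box[of "c2 * K"]]) (auto simp: S)
    show "real (card S) \<le> C * K ^ (?d - 1) * (1 + L / (R * norm m))"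
    proof (cases "S = {}")
      case True
      then show ?thesis
        using pos c2 by (simp add: C_def)
    next
      case False
      then obtain k :: "real ^ 'n"
        where k: "k \<in> int_lattice" "c1 * K \<le> infnorm k" "infnorm k \<le> c2 * K"
        using S by blast
      have "0 < c1 * K"
        using assms(1) pos by simp
      then have "k \<noteq> 0"
        using k(2) by (auto simp: infnorm_0)
      then have K1: "1 \<le> c2 * K"
        using infnorm_ge_1_if_int_lattice[OF k(1)] k(3) by linarith

      obtain j where j: "norm m \<le> real ?d * \<bar>m $ j\<bar>"
        by (rule exists_component_ge_norm)
      have nm: "0 < norm m"
        using m by simp
      then have mj: "m $ j \<noteq> 0"
        using j by auto

      let ?T = "{k \<in> int_lattice. infnorm k \<le> c2 * K \<and> \<bar>k \<bullet> m - \<tau> / (4 * R)\<bar> \<le> L / (4 * R)}"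
      have "S \<subseteq> ?T"
      proof
        fix k assume kS: "k \<in> S"
        have "k \<bullet> m - \<tau> / (4 * R) = (4 * R * (k \<bullet> m) - \<tau>) / (4 * R)"
          using pos by (simp add: field_simps)
        then have "\<bar>k \<bullet> m - \<tau> / (4 * R)\<bar> = \<bar>4 * R * (k \<bullet> m) - \<tau>\<bar> / (4 * R)"
          using pos by (simp add: abs_divide)
        also have "\<dots> \<le> L / (4 * R)"
          using kS pos by (intro divide_right_mono) (auto simp: S)
        finally show "k \<in> ?T"
          using kS by (simp add: S)
      qed
      then have "card S \<le> card ?T"
        by (intro card_mono) (rule finite_subset[OF _ finite_int_lattice_box[of "c2 * K"]], auto)
      also have "real (card ?T)
          \<le> (2 * (c2 * K) + 1) ^ (?d - 1) * (1 + 2 * (L / (4 * R)) / \<bar>m $ j\<bar>)"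
        using K1 pos mj by (intro card_slab_le) auto
      also have "\<dots> \<le> (3 * c2 * K) ^ (?d - 1) * (real ?d * (1 + L / (R * norm m)))"
      proof (intro mult_mono power_mono)
        have "2 * (L / (4 * R)) / \<bar>m $ j\<bar> \<le> L / (R * \<bar>m $ j\<bar>)"
          using pos mj by (simp add: field_simps)
        also have "\<dots> \<le> real ?d * (L / (R * norm m))"
        proof -
          have "L / (R * \<bar>m $ j\<bar>) = real ?d * (L / (R * (real ?d * \<bar>m $ j\<bar>)))"
            by simp
          also have "\<dots> \<le> real ?d * (L / (R * norm m))"
            using pos nm mj j by (intro mult_left_mono divide_left_mono mult_pos_pos) auto
          finally show ?thesis .
        qed
        finally have "2 * (L / (4 * R)) / \<bar>m $ j\<bar> \<le> real ?d * (L / (R * norm m))" .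
        moreover have "1 \<le> real ?d"
          using zero_less_card_finite[where 'a='n] by linarith
        ultimately show "1 + 2 * (L / (4 * R)) / \<bar>m $ j\<bar> \<le> real ?d * (1 + L / (R * norm m))"
          unfolding distrib_left by linarith
      qed (use K1 pos c2 in \<open>auto simp: mult.commute\<close>)
      also have "\<dots> = C * K ^ (?d - 1) * (1 + L / (R * norm m))"
        by (simp add: C_def power_mult_distrib)
      finally show ?thesis
        by simp
    qed
  qed
  moreover have "0 < C"
    using c2 by (simp add: C_def)
  ultimately show ?thesis
    unfolding Let_def by blast
qed

end
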